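(* Let $u,v,w$ be words of length $N$ and suppose that there exists at least one oriented TFPL of size $N$ with boundary $(u,v;w)$. Then: (1) $|u|_0=|v|_0=|w|_0$; (2) $u\le w$ and $v\le w$; (3) $\mathrm{d}(u)+\mathrm{d}(v)\le \mathrm{d}(w)$.
   Context: Let $N\ge 1$. $G^N$ is the induced subgraph of the square lattice $\mathbb{Z}^2$ formed by $N$ consecutive, horizontally centred rows having $3,5,\dots,2N+1$ vertices from top to bottom (e.g. row $k$ from the top consists of the points $(x,-k)$, $-k\le x\le k$). It is bipartite; vertices of the same colour as the leftmost vertex of each row are called odd, the others even. Let $B_1,\dots,B_N$ be the even vertices of the bottom row, $L_1,\dots,L_N$ the leftmost vertices of the rows, and $R_1,\dots,R_N$ the rightmost vertices of the rows, each family numbered from left to right (so $L_1$ is the leftmost vertex of the bottom row and $R_1$ the rightmost vertex of the top row). A TFPL of size $N$ is a subgraph $f$ of $G^N$ (a set of edges) such that each $L_i$ and each $R_i$ has degree $0$ or $1$, each $B_i$ has degree $1$, every other vertex has degree $2$, and no path of $f$ joins two vertices $L_i,L_j$ or two vertices $R_i,R_j$. An oriented TFPL is a TFPL together with an orientation of each of its edges such that every vertex of degree $2$ has one incoming and one outgoing edge, the edges at the $L_i$ are oriented away from $L_i$, and the edges at the $R_i$ are oriented into $R_i$. A word of length $N$ is $u=u_1\cdots u_N$ with $u_i\in\{0,1\}$; $|u|_0,|u|_1$ are the numbers of $0$s and $1$s. An oriented TFPL has boundary $(u,v;w)$ if for all $i$: $u_i=1$ iff $L_i$ has degree $1$; $v_i=0$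 iff $R_i$ has degree $1$; $w_i=1$ if $B_i$ has in-degree $1$ and $w_i=0$ if $B_i$ has out-degree $1$. $\mathrm{d}(u)$ is the number of inversions of $u$, i.e. pairs $i<j$ with $u_i=1$, $u_j=0$. The partial order on words of length $N$ is: $u\le v$ iff $|u_1\cdots u_i|_1\le |v_1\cdots v_i|_1$ for all $i=1,\dots,N$. *)

theory Defs
  imports Main
begin

(* Vertices are points (x,y) of Z^2.  Row k (from the top, 1 <= k <= N) consists
   of the points (x,-k) with -k <= x <= k. *)
type_synonym vert = "int \<times> int"

definition GV :: "nat \<Rightarrow> vert set" where
  "GV N = {(x, y). \<exists>k::int. 1 \<le> k \<and> k \<le> int N \<and> y = -k \<and> -k \<le> x \<and> x \<le> k}"

definition GE :: "nat \<Rightarrow> vert set set" where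
  "GE N = {{p, q} | p q. p \<in> GV N \<and> q \<in> GV N \<and>
              \<bar>fst p - fst q\<bar> + \<bar>snd p - snd q\<bar> = 1}"

(* B_i: i-th even vertex (from the left) of the bottom row; even vertices are those
   of colour different from the leftmost vertex (-k,-k) of their row *)
definition Bv :: "nat \<Rightarrow> nat \<Rightarrow> vert" where
  "Bv N i = (2 * int i - 1 - int N, - int N)"

(* L_i: leftmost vertex of row N+1-i (L_1 is leftmost vertex of the bottom row) *)
definition Lv :: "nat \<Rightarrow> nat \<Rightarrow> vert" where
  "Lv N i = (- (int N + 1 - int i), - (int N + 1 - int i))"

(* R_i: rightmost vertex of row i (R_1 is rightmost vertex of the top row) *)
definition Rv :: "nat \<Rightarrow> nat \<Rightarrow> vert" where
  "Rv N i = (int i, - int i)"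

definition degree :: "vert set set \<Rightarrow> vert \<Rightarrow> nat" where
  "degree f p = card {e \<in> f. p \<in> e}"

definition joined :: "vert set set \<Rightarrow> vert \<Rightarrow> vert \<Rightarrow> bool" where
  "joined f p q \<longleftrightarrow> (p, q) \<in> {(a, b). {a, b} \<in> f}\<^sup>*"

definition is_TFPL :: "nat \<Rightarrow> vert set set \<Rightarrow> bool" where
  "is_TFPL N f \<longleftrightarrow>
     f \<subseteq> GE N \<and>
     (\<forall>i\<in>{1..N}. degree f (Lv N i) \<le> 1 \<and> degree f (Rv N i) \<le> 1 \<and> degree f (Bv N i) = 1) \<and>
     (\<forall>p\<in>GV N. p \<notin> Lv N ` {1..N} \<and> p \<notin> Rv N ` {1..N} \<and> p \<notin> Bv N ` {1..N}
        \<longrightarrow> degree f p = 2) \<and>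
     (\<forall>i\<in>{1..N}. \<forall>j\<in>{1..N}. i \<noteq> j \<longrightarrow>
        \<not> joined f (Lv N i) (Lv N j) \<and> \<not> joined f (Rv N i) (Rv N j))"

(* an oriented subgraph is a set D of arcs (p,q), meaning the edge {p,q} oriented p -> q *)
definition und :: "(vert \<times> vert) set \<Rightarrow> vert set set" where
  "und D = (\<lambda>(p, q). {p, q}) ` D"

definition indeg :: "(vert \<times> vert) set \<Rightarrow> vert \<Rightarrow> nat" where
  "indeg D p = card {q. (q, p) \<in> D}"

definition outdeg :: "(vert \<times> vert) set \<Rightarrow> vert \<Rightarrow> nat" where
  "outdeg D p = card {q. (p, q) \<in> D}"

definition is_oriented_TFPL :: "nat \<Rightarrow> (vert \<times> vert) set \<Rightarrow> bool" where
  "is_oriented_TFPL N D \<longleftrightarrow>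
     is_TFPL N (und D) \<and>
     (\<forall>(p, q)\<in>D. (q, p) \<notin> D) \<and>
     (\<forall>p\<in>GV N. degree (und D) p = 2 \<longrightarrow> indeg D p = 1 \<and> outdeg D p = 1) \<and>
     (\<forall>i\<in>{1..N}. \<forall>q. (q, Lv N i) \<notin> D \<and> (Rv N i, q) \<notin> D)"

(* words: bool lists, True = letter 1, False = letter 0; u_i = u ! (i-1) *)
definition has_boundary :: "nat \<Rightarrow> (vert \<times> vert) set \<Rightarrow> bool list \<Rightarrow> bool list \<Rightarrow> bool list \<Rightarrow> bool" where
  "has_boundary N D u v w \<longleftrightarrow>
     length u = N \<and> length v = N \<and> length w = N \<and>
     (\<forall>i\<in>{1..N}.
        (u ! (i - 1) \<longleftrightarrow> degree (und D) (Lv N i) = 1) \<and>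
        (\<not> v ! (i - 1) \<longleftrightarrow> degree (und D) (Rv N i) = 1) \<and>
        (indeg D (Bv N i) = 1 \<longrightarrow> w ! (i - 1)) \<and>
        (outdeg D (Bv N i) = 1 \<longrightarrow> \<not> w ! (i - 1)))"

definition ones :: "bool list \<Rightarrow> nat" where
  "ones u = length (filter id u)"

definition zeros :: "bool list \<Rightarrow> nat" where
  "zeros u = length (filter Not u)"

definition dinv :: "bool list \<Rightarrow> nat" where
  "dinv u = card {(i, j). i < j \<and> j < length u \<and> u ! i \<and> \<not> u ! j}"

definition word_le :: "bool list \<Rightarrow> bool list \<Rightarrow> bool" where
  "word_le u v \<longleftrightarrow> (\<forall>i\<in>{1..length u}. ones (take i u) \<le> ones (take i v))"

end

theory Submission
  imports Defs
begin

text \<open>The arcs from odd to even vertices and the arcs from even to odd vertices of an oriented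
  TFPL are two disjoint matchings. Read row by row, each is a system of particles: in row \<open>k\<close>
  the particles on odd vertices may jump by one to an adjacent even vertex, the others stay.
  Blue particles enter at the left end in the rows with \<open>u = 1\<close> and finish at the positions
  with \<open>w = 1\<close>; red ones enter at the right end where \<open>v = 0\<close> and finish where
  \<open>w = 0\<close>. Counting particles gives (1), and (2) expresses that a particle moves by at
  most one per row.

  For (3), follow the number of pairs consisting of a blue and a red particle with the blue one
  weakly to the left; at the bottom it is the number of inversions of \<open>w\<close>. By parity a row
  can only destroy pairs at a common position, and since disjointness of the matchings forces
  every even site to be occupied, the number of common positions is at most the number of
  particles minus the number of rows passed.\<close>

section \<open>Hopping particles and ordered pairs\<close>

text \<open>The leftmost vertex of row \<open>k\<close> has \<open>x = - k\<close>, so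
  \<open>x + k\<close> is even exactly at the odd vertices of that row; only particles there may
  move.\<close>

definition hop :: "int \<Rightarrow> int set \<Rightarrow> int set \<Rightarrow> bool" where
  "hop k S T \<longleftrightarrow> (\<exists>h. bij_betw h S T \<and>
     (\<forall>x\<in>S. \<bar>h x - x\<bar> \<le> 1 \<and> (odd (x + k) \<longrightarrow> h x = x)))"

definition weak_pairs :: "int set \<Rightarrow> int set \<Rightarrow> nat" where
  "weak_pairs A C = card {(x, y). x \<in> A \<and> y \<in> C \<and> x \<le> y}"

lemma hop_card: "hop k S T \<Longrightarrow> card S = card T"
  unfolding hop_def using bij_betw_same_card by blast

lemma finite_weak_pairs:
  "finite A \<Longrightarrow> finite C \<Longrightarrow> finite {(x, y). x \<in> A \<and> y \<in> C \<and> x \<le> (y::int)}"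
  by (rule finite_subset[of _ "A \<times> C"]) auto

text \<open>Particles at distance 1 sit on different colours, so at most one of them moves; at
  distance 2 or more, moves by at most 1 cannot reverse the order. Strict pairs thus survive as weak
  pairs, and only pairs on a common site can be lost.\<close>

lemma weak_pairs_hop:
  assumes fin: "finite A" "finite C"
    and A: "hop k A A'" and C: "hop k C C'"
  shows "weak_pairs A C \<le> weak_pairs A' C' + card (A \<inter> C)"
proof -
  obtain h where h: "bij_betw h A A'"
      "\<And>x. x \<in> A \<Longrightarrow> \<bar>h x - x\<bar> \<le> 1 \<and> (odd (x + k) \<longrightarrow> h x = x)"
    using A unfolding hop_def by blast
  obtain g where g: "bij_betw g C C'"
      "\<And>x. x \<in> C \<Longrightarrow> \<bar>g x - x\<bar> \<le> 1 \<and> (odd (x + k) \<longrightarrow> g x = x)"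
    using C unfolding hop_def by blast
  let ?P = "{(x, y). x \<in> A \<and> y \<in> C \<and> x < y}"
  let ?Q = "{(x, y). x \<in> A' \<and> y \<in> C' \<and> x \<le> y}"
  let ?D = "(\<lambda>x. (x, x)) ` (A \<inter> C)"
  have fin': "finite A'" "finite C'"
    using fin h(1) g(1) bij_betw_finite by blast+
  have mono: "h x \<le> g y" if "x \<in> A" "y \<in> C" "x < y" for x y
  proof (cases "y = x + 1")
    case True
    then have "odd (x + k) \<or> odd (y + k)" by auto
    then show ?thesis using True h(2)[OF that(1)] g(2)[OF that(2)] by auto
  next
    case False
    then show ?thesis using that(3) h(2)[OF that(1)] g(2)[OF that(2)] by linarith
  qed
  have inj: "inj_on (map_prod h g) ?P"
    using map_prod_inj_on[of h A g C] h(1) g(1) by (auto simp: bij_betw_def elim: inj_on_subset)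
  have sub: "map_prod h g ` ?P \<subseteq> ?Q"
  proof (rule image_subsetI)
    fix p assume "p \<in> ?P"
    then obtain x y where p: "p = (x, y)" and xy: "x \<in> A" "y \<in> C" "x < y" by blast
    then have "h x \<in> A'" "g y \<in> C'" using h(1) g(1) bij_betwE by blast+
    then show "map_prod h g p \<in> ?Q" using mono[OF xy] p by simp
  qed
  have "card ?P \<le> card ?Q"
    using card_inj_on_le[OF inj sub] finite_weak_pairs[OF fin'] by blast
  moreover have "{(x, y). x \<in> A \<and> y \<in> C \<and> x \<le> y} = ?P \<union> ?D" by auto
  moreover have "card (?P \<union> ?D) \<le> card ?P + card ?D" by (rule card_Un_le)
  moreover have "card ?D = card (A \<inter> C)" by (simp add: card_image inj_on_def)
  ultimately show ?thesis unfolding weak_pairs_def by simp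
qed

lemma weak_pairs_insert_left:
  assumes "finite A" "finite C" "a \<notin> A" "\<And>y. y \<in> C \<Longrightarrow> a \<le> y"
  shows "weak_pairs (insert a A) C = weak_pairs A C + card C"
proof -
  have "{(x, y). x \<in> insert a A \<and> y \<in> C \<and> x \<le> y}
      = {(x, y). x \<in> A \<and> y \<in> C \<and> x \<le> y} \<union> Pair a ` C"
    using assms by auto
  moreover have "card (\<dots>) = card {(x, y). x \<in> A \<and> y \<in> C \<and> x \<le> y} + card (Pair a ` C)"
    by (rule card_Un_disjoint) (use assms finite_weak_pairs[OF assms(1,2)] in auto)
  ultimately show ?thesis
    unfolding weak_pairs_def by (simp add: card_image inj_on_def)
qed

lemma weak_pairs_insert_right:
  assumes "finite A" "finite C" "c \<notin> C" "\<And>x. x \<in> A \<Longrightarrow> x \<le> c"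
  shows "weak_pairs A (insert c C) = weak_pairs A C + card A"
proof -
  have "{(x, y). x \<in> A \<and> y \<in> insert c C \<and> x \<le> y}
      = {(x, y). x \<in> A \<and> y \<in> C \<and> x \<le> y} \<union> (\<lambda>x. (x, c)) ` A"
    using assms by auto
  moreover have "card (\<dots>) = card {(x, y). x \<in> A \<and> y \<in> C \<and> x \<le> y} + card ((\<lambda>x. (x, c)) ` A)"
    by (rule card_Un_disjoint) (use assms finite_weak_pairs[OF assms(1,2)] in auto)
  ultimately show ?thesis
    unfolding weak_pairs_def by (simp add: card_image inj_on_def)
qed

section \<open>Letter counts and inversions of words\<close>

lemma ones_conv_card: "ones u = card {i. i < length u \<and> u ! i}"
  by (simp add: ones_def length_filter_conv_card)

lemma zeros_conv_card: "zeros u = card {i. i < length u \<and> \<not> u ! i}"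
  by (simp add: zeros_def length_filter_conv_card)

lemma ones_plus_zeros: "ones u + zeros u = length u"
  unfolding ones_def zeros_def by (induction u) auto

lemma ones_simps [simp]:
  "ones [] = 0" "ones (a # u) = (if a then 1 else 0) + ones u" "ones (u @ v) = ones u + ones v"
  by (auto simp: ones_def)

lemma zeros_simps [simp]:
  "zeros [] = 0" "zeros (a # u) = (if a then 0 else 1) + zeros u" "zeros (u @ v) = zeros u + zeros v"
  by (auto simp: zeros_def)

lemma finite_inversions: "finite {(i, j). i < j \<and> j < length u \<and> u ! i \<and> \<not> u ! j}"
  by (rule finite_subset[of _ "{..<length u} \<times> {..<length u}"]) auto

lemma dinv_Nil [simp]: "dinv [] = 0"
  by (simp add: dinv_def)

text \<open>Passing a row puts a letter in front of the part of \<open>u\<close> already read, since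
  the \<open>Lv\<close> are numbered from the bottom, and behind that of \<open>v\<close>; hence
  this rule and its mirror image for appending.\<close>

lemma dinv_Cons: "dinv (a # u) = dinv u + (if a then zeros u else 0)"
proof -
  define I where "I = {(i, j). i < j \<and> j < length u \<and> u ! i \<and> \<not> u ! j}"
  define Z where "Z = {j. a \<and> j < length u \<and> \<not> u ! j}"
  have "{(i, j). i < j \<and> j < length (a # u) \<and> (a # u) ! i \<and> \<not> (a # u) ! j}
      = map_prod Suc Suc ` I \<union> (\<lambda>j. (0, Suc j)) ` Z" (is "?L = ?R")
  proof (rule set_eqI)
    fix p :: "nat \<times> nat"
    obtain i j where p: "p = (i, j)" by (cases p)
    show "p \<in> ?L \<longleftrightarrow> p \<in> ?R"
      unfolding p by (cases i; cases j) (auto simp: I_def Z_def image_iff)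
  qed
  moreover have "card ?R = card (map_prod Suc Suc ` I) + card ((\<lambda>j. (0::nat, Suc j)) ` Z)"
  proof (rule card_Un_disjoint)
    show "finite (map_prod Suc Suc ` I)"
      unfolding I_def by (intro finite_imageI finite_inversions)
    show "finite ((\<lambda>j. (0::nat, Suc j)) ` Z)" by (simp add: Z_def)
    show "map_prod Suc Suc ` I \<inter> (\<lambda>j. (0, Suc j)) ` Z = {}" by auto
  qed
  moreover have "card (map_prod Suc Suc ` I) = card I"
    by (rule card_image) (auto simp: inj_on_def)
  moreover have "card ((\<lambda>j. (0::nat, Suc j)) ` Z) = card Z"
    by (rule card_image) (simp add: inj_on_def)
  moreover have "card Z = (if a then zeros u else 0)"
    by (simp add: Z_def zeros_conv_card)
  ultimately show ?thesis unfolding dinv_def I_def[symmetric] by presburger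
qed

lemma dinv_append_single: "dinv (u @ [b]) = dinv u + (if b then 0 else ones u)"
  by (induction u) (auto simp: dinv_Cons)

text \<open>Position of the \<open>i\<close>-th even vertex of the bottom row, with \<open>i\<close> counted from \<open>0\<close>.\<close>

definition bpos :: "nat \<Rightarrow> nat \<Rightarrow> int" where
  "bpos N i = 2 * int i + 1 - int N"

lemma inj_bpos [simp]: "inj_on (bpos N) S"
  by (auto simp: inj_on_def bpos_def)

lemma weak_pairs_bottom:
  assumes "length w = N"
  shows "weak_pairs (bpos N ` {i. i < N \<and> w ! i}) (bpos N ` {i. i < N \<and> \<not> w ! i}) = dinv w"
proof -
  let ?I = "{(i, j). i < j \<and> j < length w \<and> w ! i \<and> \<not> w ! j}"
  have "{(x, y). x \<in> bpos N ` {i. i < N \<and> w ! i} \<and> y \<in> bpos N ` {i. i < N \<and> \<not> w ! i} \<and> x \<le> y}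
      = map_prod (bpos N) (bpos N) ` ?I" (is "?L = ?R")
  proof (intro equalityI subsetI)
    fix p assume "p \<in> ?L"
    then obtain i j where ij: "p = (bpos N i, bpos N j)" "i < N" "w ! i" "j < N" "\<not> w ! j"
      "bpos N i \<le> bpos N j" by auto
    \<comment> \<open>The letters of \<open>w\<close> at \<open>i\<close> and \<open>j\<close>
      differ, which makes the weak order strict.\<close>
    then have "i \<noteq> j" "i \<le> j" by (auto simp: bpos_def)
    then have "(i, j) \<in> ?I" using ij assms by auto
    then have "map_prod (bpos N) (bpos N) (i, j) \<in> ?R" by (rule imageI)
    then show "p \<in> ?R" unfolding ij(1) map_prod_simp .
  qed (use assms in \<open>auto simp: bpos_def\<close>)
  moreover have "card (map_prod (bpos N) (bpos N) ` ?I) = card ?I"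
    by (rule card_image) (auto simp: inj_on_def bpos_def)
  ultimately show ?thesis by (simp add: weak_pairs_def dinv_def)
qed

section \<open>Particle systems: counts, pair bounds and the order on words\<close>

text \<open>A particle entering at \<open>-\<sigma> j\<close> in row \<open>j\<close> and moving by at most one per row
  satisfies \<open>\<sigma> x \<le> k + 1 - 2 j\<close> after row \<open>k\<close>.\<close>

lemma entering_particles_bound:
  fixes A :: "nat \<Rightarrow> int set" and \<sigma> :: int
  assumes sg: "\<bar>\<sigma>\<bar> = 1"
    and fin: "\<And>k. finite (A k)" and rng: "\<And>k. A k \<subseteq> {- int k..int k}"
    and step: "\<And>k. k < N \<Longrightarrow>
      hop (int (Suc k)) (A k \<union> (if s (Suc k) then {- \<sigma> * int (Suc k)} else {})) (A (Suc k))"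
    and "k \<le> N"
  shows "card {j. m < j \<and> j \<le> k \<and> s j} \<le> card {x \<in> A k. \<sigma> * x \<le> int k - 1 - 2 * int m}"
  using \<open>k \<le> N\<close>
proof (induction k)
  case 0
  have "{j. m < j \<and> j \<le> 0 \<and> s j} = {}" by auto
  then show ?case by (metis card.empty le0)
next
  case (Suc k)
  let ?F = "{x \<in> A k. \<sigma> * x \<le> int k - 1 - 2 * int m}"
  let ?G = "{x \<in> A (Suc k). \<sigma> * x \<le> int (Suc k) - 1 - 2 * int m}"
  let ?J = "\<lambda>k. {j. m < j \<and> j \<le> k \<and> s j}"
  let ?e = "- \<sigma> * int (Suc k)"
  let ?S = "A k \<union> (if s (Suc k) then {?e} else {})"
  obtain h where h: "bij_betw h ?S (A (Suc k))" "\<And>x. x \<in> ?S \<Longrightarrow> \<bar>h x - x\<bar> \<le> 1"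
    using step[of k] Suc.prems unfolding hop_def by (meson Suc_le_lessD)
  have sg': "\<sigma> = 1 \<or> \<sigma> = -1" using sg by linarith
  have mv: "\<sigma> * h x \<le> \<sigma> * x + 1" if "x \<in> ?S" for x
    using h(2)[OF that] sg' by auto
  have e: "?e \<notin> A k" using rng[of k] sg' by auto
  have IH: "card (?J k) \<le> card ?F" using Suc by simp
  \<comment> \<open>\<open>h\<close> is injective and raises \<open>\<sigma> * x\<close> by at most
    1, just as the threshold rises by 1 from one row to the next.\<close>
  have le: "card U \<le> card ?G" if "U \<subseteq> ?S" "\<And>x. x \<in> U \<Longrightarrow> \<sigma> * x \<le> int k - 1 - 2 * int m" for U
  proof (rule card_inj_on_le)
    show "inj_on h U" using h(1) that(1) by (meson bij_betw_def inj_on_subset)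
    show "h ` U \<subseteq> ?G"
    proof
      fix y assume "y \<in> h ` U"
      then obtain x where x: "x \<in> U" "y = h x" by blast
      then have "x \<in> ?S" using that(1) by blast
      then have "y \<in> A (Suc k)" using x(2) bij_betwE[OF h(1)] by blast
      moreover have "\<sigma> * y \<le> int k - 2 * int m"
        using mv[OF \<open>x \<in> ?S\<close>] that(2)[OF x(1)] unfolding x(2) by linarith
      ultimately show "y \<in> ?G" by auto
    qed
    show "finite ?G" using fin by simp
  qed
  show ?case
  proof (cases "s (Suc k) \<and> m < Suc k")
    case True
    have "?J (Suc k) = insert (Suc k) (?J k)" using True by (auto simp: le_Suc_eq)
    then have "card (?J (Suc k)) = Suc (card (?J k))" by simp
    also have "\<dots> \<le> card (insert ?e ?F)" using IH e fin by simp
    also have "\<dots> \<le> card ?G"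
    proof (rule le)
      \<comment> \<open>The entering site meets the threshold because
        \<open>- (k + 1) \<le> k - 1 - 2 m\<close> holds exactly when
        \<open>m < Suc k\<close>.\<close>
      have "\<sigma> * ?e = - int (Suc k)" using sg' by auto
      then show "\<sigma> * x \<le> int k - 1 - 2 * int m" if "x \<in> insert ?e ?F" for x
        using that True by auto
    qed (use True in auto)
    finally show ?thesis .
  next
    case False
    have "?J (Suc k) = ?J k" using False by (auto simp: le_Suc_eq)
    moreover have "card ?F \<le> card ?G" by (rule le) auto
    ultimately show ?thesis using IH by simp
  qed
qed

text \<open>\<open>A k\<close> and \<open>C k\<close> are the blue and red configurations after row
  \<open>k\<close>. Row \<open>k + 1\<close> begins at \<open>Lv N (N - k)\<close>, hence the
  zero-based index \<open>N - Suc k\<close> into \<open>u\<close>. Apart from the bottom row, only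
  \<open>cover\<close> links the two systems.\<close>

locale particle_rows =
  fixes N :: nat and u v w :: "bool list" and A C :: "nat \<Rightarrow> int set"
  assumes len: "length u = N" "length v = N" "length w = N"
    and A0: "A 0 = {}" and C0: "C 0 = {}"
    and A_range: "A k \<subseteq> {- int k..int k}" and C_range: "C k \<subseteq> {- int k..int k}"
    and A_step: "k < N \<Longrightarrow>
      hop (int (Suc k)) (A k \<union> (if u ! (N - Suc k) then {- int (Suc k)} else {})) (A (Suc k))"
    and C_step: "k < N \<Longrightarrow>
      hop (int (Suc k)) (C k \<union> (if v ! k then {} else {int (Suc k)})) (C (Suc k))"
    and cover: "k < N \<Longrightarrow> \<bar>x\<bar> \<le> int k \<Longrightarrow> odd (x + int k) \<Longrightarrow> x \<in> A k \<union> C k"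
    and A_bottom: "A N = bpos N ` {i. i < N \<and> w ! i}"
    and C_bottom: "C N = bpos N ` {i. i < N \<and> \<not> w ! i}"
begin

lemma fin [simp]: "finite (A k)" "finite (C k)"
  by (rule finite_subset[OF A_range], simp) (rule finite_subset[OF C_range], simp)

lemma drop_u_Suc: "k < N \<Longrightarrow> drop (N - Suc k) u = u ! (N - Suc k) # drop (N - k) u"
  using Cons_nth_drop_Suc[of "N - Suc k" u] len by (simp add: Suc_diff_Suc)

lemma take_v_Suc: "k < N \<Longrightarrow> take (Suc k) v = take k v @ [v ! k]"
  using len by (simp add: take_Suc_conv_app_nth)

lemma new_A: "- int (Suc k) \<notin> A k" and new_C: "int (Suc k) \<notin> C k"
  using A_range[of k] C_range[of k] by auto

lemma card_A: "k \<le> N \<Longrightarrow> card (A k) = ones (drop (N - k) u)"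
proof (induction k)
  case 0 then show ?case using len A0 by simp
next
  case (Suc k)
  then show ?case using hop_card[OF A_step[of k]] drop_u_Suc[of k] new_A[of k] by auto
qed

lemma card_C: "k \<le> N \<Longrightarrow> card (C k) = zeros (take k v)"
proof (induction k)
  case 0 then show ?case using C0 by simp
next
  case (Suc k)
  then show ?case using hop_card[OF C_step[of k]] take_v_Suc[of k] new_C[of k] by auto
qed

lemma ones_u: "ones u = ones w"
  using card_A[of N] A_bottom len by (simp add: card_image ones_conv_card)

lemma zeros_v: "zeros v = zeros w"
  using card_C[of N] C_bottom len by (simp add: card_image zeros_conv_card)

lemma zeros_u: "zeros u = zeros w"
  using ones_u ones_plus_zeros[of u] ones_plus_zeros[of w] len by simp

text \<open>All \<open>k\<close> even sites of row \<open>k\<close> are occupied, so the union has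
  at least \<open>k\<close> elements; then inclusion-exclusion applies.\<close>

lemma card_inter_bound:
  assumes "k < N"
  shows "k + card (A k \<inter> C k) \<le> card (A k) + card (C k)"
proof -
  \<comment> \<open>The formula for the bottom row, with \<open>k\<close> in place of
    \<open>N\<close>, lists the even sites of row \<open>k\<close>.\<close>
  have "bpos k ` {..<k} \<subseteq> A k \<union> C k"
  proof (rule image_subsetI)
    fix i assume "i \<in> {..<k}"
    then show "bpos k i \<in> A k \<union> C k" by (intro cover[OF assms]) (auto simp: bpos_def)
  qed
  then have "card (bpos k ` {..<k}) \<le> card (A k \<union> C k)"
    by (intro card_mono) auto
  then have "k \<le> card (A k \<union> C k)" by (simp add: card_image)
  then show ?thesis using card_Un_Int[of "A k" "C k"] by simp
qed

text \<open>The excess \<open>E = |A| + |C| - k\<close> bounds the number of doubly occupied sites, hence the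
  number of weak pairs that one row can destroy; the triangular number \<open>E (E + 1) / 2\<close>
  compensates exactly for this loss and for the particles entering at the two ends.\<close>

lemma weak_pairs_excess:
  assumes "k \<le> N"
  shows "2 * int (dinv (drop (N - k) u)) + 2 * int (dinv (take k v))
      + (int (card (A k)) + int (card (C k)) - int k) * (int (card (A k)) + int (card (C k)) - int k + 1)
    \<le> 2 * int (weak_pairs (A k) (C k))"
  using assms
proof (induction k)
  case 0
  then show ?case using len A0 C0 by simp
next
  case (Suc k)
  then have k: "k < N" by simp
  let ?a = "u ! (N - Suc k)" and ?b = "v ! k"
  let ?SA = "A k \<union> (if ?a then {- int (Suc k)} else {})"
  let ?SC = "C k \<union> (if ?b then {} else {int (Suc k)})"
  \<comment> \<open>Particles enter at \<open>- (k + 1)\<close> and \<open>k + 1\<close>, beyond all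
    others, so no new double occupation arises.\<close>
  have inter: "?SA \<inter> ?SC = A k \<inter> C k"
    using A_range[of k] C_range[of k] by auto
  \<comment> \<open>The pair of two entering particles is counted once, within
    \<open>card ?SC\<close>.\<close>
  have pairs: "weak_pairs ?SA ?SC = weak_pairs (A k) (C k) + (if ?a then card ?SC else 0)
      + (if ?b then 0 else card (A k))"
  proof -
    have "weak_pairs (A k) ?SC = weak_pairs (A k) (C k) + (if ?b then 0 else card (A k))"
      using weak_pairs_insert_right[of "A k" "C k" "int (Suc k)"] new_C[of k] A_range[of k] by force
    moreover have "weak_pairs ?SA ?SC = weak_pairs (A k) ?SC + (if ?a then card ?SC else 0)"
      using weak_pairs_insert_left[of "A k" ?SC "- int (Suc k)"] new_A[of k] C_range[of k] by force
    ultimately show ?thesis by simp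
  qed
  have loss: "weak_pairs ?SA ?SC \<le> weak_pairs (A (Suc k)) (C (Suc k)) + card (A k \<inter> C k)"
    using weak_pairs_hop[OF _ _ A_step[OF k] C_step[OF k]] unfolding inter by simp
  have cA: "card (A (Suc k)) = card (A k) + (if ?a then 1 else 0)"
    using hop_card[OF A_step[OF k]] new_A[of k] by auto
  have cC: "card (C (Suc k)) = card (C k) + (if ?b then 0 else 1)"
    "card ?SC = card (C k) + (if ?b then 0 else 1)"
    using hop_card[OF C_step[OF k]] new_C[of k] by auto
  have zA: "int (zeros (drop (N - k) u)) = int k - int (card (A k))"
    using ones_plus_zeros[of "drop (N - k) u"] card_A[of k] k len by simp
  have oC: "int (ones (take k v)) = int k - int (card (C k))"
    using ones_plus_zeros[of "take k v"] card_C[of k] k len by simp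
  have "int k + int (card (A k \<inter> C k)) \<le> int (card (A k)) + int (card (C k))"
    using card_inter_bound[OF k] by linarith
  moreover have "int (weak_pairs ?SA ?SC)
      \<le> int (weak_pairs (A (Suc k)) (C (Suc k))) + int (card (A k \<inter> C k))"
    using loss by linarith
  moreover have "dinv (drop (N - Suc k) u) = dinv (drop (N - k) u) + (if ?a then zeros (drop (N - k) u) else 0)"
    using drop_u_Suc[OF k] by (simp add: dinv_Cons)
  moreover have "dinv (take (Suc k) v) = dinv (take k v) + (if ?b then 0 else ones (take k v))"
    using take_v_Suc[OF k] by (simp add: dinv_append_single)
  \<comment> \<open>In each of the four cases the left side grows by twice the number of pairs
    created by entering, minus \<open>2 E\<close>. Everything thus reduces to
    \<open>card (A k \<inter> C k) \<le> E\<close>.\<close>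
  ultimately show ?case
    using Suc.IH k zA oC unfolding pairs cA cC
    by (cases ?a; cases ?b) (simp_all add: algebra_simps)
qed

lemma dinv_bound: "dinv u + dinv v \<le> dinv w"
proof -
  \<comment> \<open>At the bottom the excess is 0, so the triangular term vanishes.\<close>
  have "card (A N) + card (C N) = N"
    using card_A[of N] card_C[of N] ones_u zeros_v ones_plus_zeros[of w] len by simp
  then have "int (card (A N)) + int (card (C N)) - int N = 0" by linarith
  then show ?thesis
    using weak_pairs_excess[of N] len weak_pairs_bottom[of w N] A_bottom C_bottom by simp
qed

text \<open>The first \<open>i\<close> letters of \<open>u\<close> belong to the lowest
  \<open>i\<close> rows, and a particle entering there is too late to get beyond the first
  \<open>i\<close> bottom sites.\<close>

lemma u_le_w: "word_le u w"
  unfolding word_le_def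
proof
  fix i assume i: "i \<in> {1..length u}"
  let ?J = "{j. N - i < j \<and> j \<le> N \<and> u ! (N - j)}"
  have "bij_betw (\<lambda>j. N - j) ?J {t. t < i \<and> u ! t}"
    by (rule bij_betw_byWitness[where f' = "\<lambda>t. N - t"]) (use i len in auto)
  then have "card {t. t < i \<and> u ! t} = card ?J" by (simp add: bij_betw_same_card)
  also have "\<dots> \<le> card {x \<in> A N. 1 * x \<le> int N - 1 - 2 * int (N - i)}"
  proof (rule entering_particles_bound[where N = N])
    fix k assume "k < N"
    then show "hop (int (Suc k)) (A k \<union> (if u ! (N - Suc k) then {- 1 * int (Suc k)} else {})) (A (Suc k))"
      using A_step[of k] by (cases "u ! (N - Suc k)") simp_all
  qed (simp_all only: fin A_range abs_one order_refl)
  \<comment> \<open>With \<open>m = N - i\<close> the threshold equals \<open>2 i - 1 - N\<close>,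
    the position of the \<open>i\<close>-th bottom site.\<close>
  also have "{x \<in> A N. 1 * x \<le> int N - 1 - 2 * int (N - i)} = bpos N ` {t. t < i \<and> w ! t}"
    unfolding A_bottom using i len by (auto simp: bpos_def)
  also have "card \<dots> = card {t. t < i \<and> w ! t}" by (simp add: card_image)
  finally show "ones (take i u) \<le> ones (take i w)"
    using i len by (simp add: ones_conv_card cong: conj_cong)
qed

text \<open>The mirror argument for red particles entering after row \<open>i\<close> compares zeros
  of suffixes; equal totals of zeros turn this into a comparison of ones of prefixes.\<close>

lemma v_le_w: "word_le v w"
  unfolding word_le_def
proof
  fix i assume i: "i \<in> {1..length v}"
  let ?J = "{j. i < j \<and> j \<le> N \<and> \<not> v ! (j - 1)}"
  let ?Z = "\<lambda>w. {t. t < N - i \<and> \<not> w ! (i + t)}"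
  have "bij_betw (\<lambda>j. j - 1 - i) ?J (?Z v)"
    by (rule bij_betw_byWitness[where f' = "\<lambda>t. i + t + 1"]) (use i len in auto)
  then have "card (?Z v) = card ?J" by (simp add: bij_betw_same_card)
  also have "\<dots> \<le> card {x \<in> C N. (-1) * x \<le> int N - 1 - 2 * int i}"
  proof (rule entering_particles_bound[where N = N])
    fix k assume "k < N"
    then show "hop (int (Suc k)) (C k \<union> (if \<not> v ! (Suc k - 1) then {- (- 1) * int (Suc k)} else {})) (C (Suc k))"
      using C_step[of k] by (cases "v ! k") simp_all
  qed (simp_all only: fin C_range abs_minus_cancel abs_one order_refl)
  also have "{x \<in> C N. (-1) * x \<le> int N - 1 - 2 * int i} = bpos N ` (\<lambda>t. i + t) ` ?Z w"
  proof -
    have "{t. t < N \<and> i \<le> t \<and> \<not> w ! t} = (\<lambda>t. i + t) ` ?Z w"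
    proof (intro equalityI subsetI)
      fix t assume "t \<in> {t. t < N \<and> i \<le> t \<and> \<not> w ! t}"
      then have "t = i + (t - i)" "t - i \<in> ?Z w" by auto
      then show "t \<in> (\<lambda>t. i + t) ` ?Z w" by (rule image_eqI)
    qed auto
    moreover have "{x \<in> C N. (-1) * x \<le> int N - 1 - 2 * int i}
        = bpos N ` {t. t < N \<and> i \<le> t \<and> \<not> w ! t}"
      unfolding C_bottom by (auto simp: bpos_def)
    ultimately show ?thesis by simp
  qed
  also have "card \<dots> = card (?Z w)" by (simp add: card_image)
  finally have "zeros (drop i v) \<le> zeros (drop i w)"
    using i len by (simp add: zeros_conv_card cong: conj_cong)
  moreover have "zeros v = zeros (take i v) + zeros (drop i v)"
    "zeros w = zeros (take i w) + zeros (drop i w)"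
    using zeros_simps(3) append_take_drop_id by metis+
  ultimately show "ones (take i v) \<le> ones (take i w)"
    using zeros_v ones_plus_zeros[of "take i v"] ones_plus_zeros[of "take i w"] i len by simp
qed

end

section \<open>From an arc matching to a particle system\<close>

lemma GV_iff: "(x, y) \<in> GV N \<longleftrightarrow> 1 \<le> - y \<and> - y \<le> int N \<and> \<bar>x\<bar> \<le> - y"
  unfolding GV_def by (auto intro!: exI[of _ "- y"])

text \<open>The arcs from odd to even vertices form a matching that covers every vertex outside the
  boundary. It is read as a particle configuration \<open>row k\<close> between rows \<open>k\<close> and \<open>k + 1\<close>:
  below an odd vertex a particle means that the matching uses the vertical edge, below an even
  vertex it means that the matching does not use it. The arcs from even to odd vertices
  are treated by the same locale, applied to the converse of \<open>D\<close>.\<close>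

locale arc_matching =
  fixes N :: nat and D :: "(vert \<times> vert) set"
  assumes arc: "(p, q) \<in> D \<Longrightarrow> p \<in> GV N \<and> q \<in> GV N \<and> \<bar>fst p - fst q\<bar> + \<bar>snd p - snd q\<bar> = 1"
    and out_unique: "(p, q) \<in> D \<Longrightarrow> (p, q') \<in> D \<Longrightarrow> even (fst p + snd p) \<Longrightarrow> q = q'"
    and in_unique: "(q, p) \<in> D \<Longrightarrow> (q', p) \<in> D \<Longrightarrow> odd (fst p + snd p) \<Longrightarrow> q = q'"
    and out_ex: "p \<in> GV N \<Longrightarrow> even (fst p + snd p) \<Longrightarrow> \<bar>fst p\<bar> < - snd p \<Longrightarrow> \<exists>q. (p, q) \<in> D"
    and in_ex: "p \<in> GV N \<Longrightarrow> odd (fst p + snd p) \<Longrightarrow> - snd p < int N \<Longrightarrow> \<exists>q. (q, p) \<in> D"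
begin

definition row :: "nat \<Rightarrow> int set" where
  "row k = {x. \<bar>x\<bar> \<le> int k \<and>
     (if even (x + int k) then ((x, - int k), (x, - int k - 1)) \<in> D
      else \<exists>q. (q, (x, - int k)) \<in> D \<and> - int k \<le> snd q)}"

definition entering :: "nat \<Rightarrow> int set" where
  "entering k = {x. \<bar>x\<bar> = int k \<and> (\<exists>q. ((x, - int k), q) \<in> D)}"

lemma row_range: "row k \<subseteq> {- int k..int k}"
  by (auto simp: row_def)

lemma row_even_iff:
  assumes "even (x + int k)"
  shows "x \<in> row k \<longleftrightarrow> ((x, - int k), (x, - int k - 1)) \<in> D"
  using assms arc[of "(x, - int k)" "(x, - int k - 1)"] by (auto simp: row_def GV_iff)

lemma row_odd_iff:
  assumes "odd (x + int k)"
  shows "x \<in> row k \<longleftrightarrow> (\<exists>q. (q, (x, - int k)) \<in> D \<and> - int k \<le> snd q)"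
proof -
  have "\<bar>x\<bar> \<le> int k" if "(q, (x, - int k)) \<in> D" for q
    using arc[OF that] by (auto simp: GV_iff)
  then show ?thesis using assms unfolding row_def by fastforce
qed

lemma row_0: "row 0 = {}"
  using arc[of "(0, 0)"] by (auto simp: row_def GV_iff)

lemma neighbour:
  assumes "((x, y), q) \<in> D \<or> (q, (x, y)) \<in> D"
  shows "q = (x, y + 1) \<or> q = (x, y - 1) \<or> q = (x + 1, y) \<or> q = (x - 1, y)"
proof -
  obtain a b where q: "q = (a, b)" by (cases q)
  have "\<bar>x - a\<bar> + \<bar>y - b\<bar> = 1" using assms arc unfolding q by fastforce
  then show ?thesis unfolding q by (auto simp: abs_if split: if_splits)
qed

text \<open>A particle arriving from the even vertex above means that the matching avoids the
  vertical edge between the two, so the arc leaving the odd vertex goes sideways or down. At an end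
  of the row there is no vertex above.\<close>

lemma moving_iff:
  assumes "k < N" "even (x + int (Suc k))"
  shows "x \<in> row k \<union> entering (Suc k) \<longleftrightarrow>
    (\<exists>q. ((x, - int (Suc k)), q) \<in> D \<and> snd q \<le> - int (Suc k))" (is "?L = ?R")
proof
  assume L: ?L
  have "\<exists>q. ((x, - int (Suc k)), q) \<in> D"
  proof (cases "x \<in> entering (Suc k)")
    case True then show ?thesis by (auto simp: entering_def)
  next
    case False
    then have "\<bar>x\<bar> \<le> int k" using L by (auto simp: row_def)
    then show ?thesis using assms by (intro out_ex) (auto simp: GV_iff)
  qed
  then obtain q where q: "((x, - int (Suc k)), q) \<in> D" by blast
  have "q \<noteq> (x, - int k)"
  proof
    assume qk: "q = (x, - int k)"
    then have "\<bar>x\<bar> \<le> int k" using q arc[OF q] by (auto simp: GV_iff)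
    then have "x \<in> row k" using L by (auto simp: entering_def)
    then obtain q' where q': "(q', (x, - int k)) \<in> D" "- int k \<le> snd q'"
      using assms(2) row_odd_iff[of x k] by auto
    have "q' = (x, - int (Suc k))"
      using in_unique[OF q'(1)] q assms(2) unfolding qk by auto
    then show False using q'(2) by simp
  qed
  then have "snd q \<le> - int (Suc k)" using neighbour[OF disjI1[OF q]] by auto
  then show ?R using q by blast
next
  assume ?R
  then obtain q where q: "((x, - int (Suc k)), q) \<in> D" "snd q \<le> - int (Suc k)" by blast
  show ?L
  proof (cases "\<bar>x\<bar> = int (Suc k)")
    case True then show ?thesis using q unfolding entering_def by blast
  next
    case False
    then have x: "\<bar>x\<bar> \<le> int k" using arc[OF q(1)] by (auto simp: GV_iff)
    \<comment> \<open>In the top row \<open>x = 0\<close> is an even vertex, so an odd vertex that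
      is not an end has a vertex of \<open>GV N\<close> above it.\<close>
    have "k > 0"
    proof (rule ccontr)
      assume "\<not> k > 0"
      then show False using x assms(2) by auto
    qed
    then obtain q' where q': "(q', (x, - int k)) \<in> D"
      using in_ex[of "(x, - int k)"] x assms by (auto simp: GV_iff)
    have "q' \<noteq> (x, - int (Suc k))"
    proof
      assume "q' = (x, - int (Suc k))"
      then have "q = (x, - int k)" using out_unique[OF q(1)] q' assms(2) by auto
      then show False using q(2) by simp
    qed
    then have "- int k \<le> snd q'" using neighbour[OF disjI2[OF q']] by auto
    moreover have "odd (x + int k)" using assms(2) by auto
    ultimately have "x \<in> row k" using q' row_odd_iff by blast
    then show ?thesis by blast
  qed
qed

text \<open>Row ends are odd vertices, so nothing enters here; the site above is odd, where a
  particle means a vertical arc.\<close>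

lemma staying_iff:
  assumes "k < N" "odd (x + int (Suc k))"
  shows "x \<in> row k \<union> entering (Suc k) \<longleftrightarrow> ((x, - int k), (x, - int (Suc k))) \<in> D"
proof -
  have "\<bar>x\<bar> \<noteq> int (Suc k)"
  proof
    assume "\<bar>x\<bar> = int (Suc k)"
    then have "x = int (Suc k) \<or> x = - int (Suc k)" by linarith
    then show False using assms(2) by auto
  qed
  then have "x \<notin> entering (Suc k)" by (auto simp: entering_def)
  moreover have "- int (Suc k) = - int k - 1" by simp
  moreover have "even (x + int k)" using assms(2) by auto
  ultimately show ?thesis using row_even_iff by (metis Un_iff)
qed

text \<open>The bijection sends a particle on an odd vertex to the column where its arc ends and
  fixes those on even vertices.\<close>

lemma row_hop:
  assumes k: "k < N"
  shows "hop (int (Suc k)) (row k \<union> entering (Suc k)) (row (Suc k))"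
proof -
  let ?y = "- int (Suc k)"
  let ?S = "row k \<union> entering (Suc k)"
  define h where "h x = (if even (x + int (Suc k)) then fst (THE q. ((x, ?y), q) \<in> D) else x)" for x
  have h_odd: "h x = x" if "odd (x + int (Suc k))" for x
    using that by (simp add: h_def)
  have h_arc: "h x = fst q" if "((x, ?y), q) \<in> D" "even (x + int (Suc k))" for x q
  proof -
    have "(THE q. ((x, ?y), q) \<in> D) = q"
      using that by (intro the_equality) (auto intro: out_unique)
    then show ?thesis using that(2) by (simp add: h_def)
  qed
  have moves: "((x, ?y), (h x, ?y)) \<in> D \<and> \<bar>h x - x\<bar> = 1 \<or> ((x, ?y), (x, ?y - 1)) \<in> D \<and> h x = x"
    if x: "x \<in> ?S" "even (x + int (Suc k))" for x
  proof -
    obtain q where q: "((x, ?y), q) \<in> D" "snd q \<le> ?y"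
      using moving_iff[OF k x(2)] x(1) by blast
    then show ?thesis using neighbour[OF disjI1[OF q(1)]] h_arc[OF q(1) x(2)] by auto
  qed
  have above: "((x, - int k), (x, ?y)) \<in> D" if "x \<in> ?S" "odd (x + int (Suc k))" for x
    using staying_iff[OF k that(2)] that(1) by blast
  have hop1: "\<bar>h x - x\<bar> \<le> 1" if "x \<in> ?S" for x
    using moves[OF that] h_odd[of x] by (cases "even (x + int (Suc k))") auto
  text \<open>Since an even vertex has at most one incoming arc, two particles cannot collide there.\<close>
  have source: "\<exists>p. (p, (h x, ?y)) \<in> D \<and> ?y \<le> snd p \<and> fst p = x"
    if "x \<in> ?S" "odd (h x + int (Suc k))" for x
  proof (cases "even (x + int (Suc k))")
    case True
    then have "h x \<noteq> x" using that(2) by metis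
    then show ?thesis using moves[OF that(1) True] by force
  next
    case False
    then show ?thesis using above[OF that(1) False] h_odd[OF False] by force
  qed
  \<comment> \<open>A jump changes the parity of the column, so a particle found on an odd site has
    not moved.\<close>
  have stay: "h x = x" if "x \<in> ?S" "even (h x + int (Suc k))" for x
  proof (rule ccontr)
    assume ne: "h x \<noteq> x"
    then have ev: "even (x + int (Suc k))" using h_odd by blast
    then have "\<bar>h x - x\<bar> = 1" using moves[OF that(1)] ne by blast
    then have "h x = x + 1 \<or> h x = x - 1" by linarith
    then show False using ev that(2) by auto
  qed
  have into: "h x \<in> row (Suc k)" if x: "x \<in> ?S" for x
  proof (cases "even (h x + int (Suc k))")
    case True
    then have hx: "h x = x" using stay x by blast
    then have d: "((x, ?y), (x, ?y - 1)) \<in> D" using moves[OF x] True by auto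
    then show ?thesis using hx True row_even_iff by metis
  next
    case False
    then show ?thesis using source[OF x False] row_odd_iff[OF False] by blast
  qed
  have inj: "inj_on h ?S"
  proof (rule inj_onI)
    fix x x' assume x: "x \<in> ?S" "x' \<in> ?S" "h x = h x'"
    show "x = x'"
    proof (cases "even (h x + int (Suc k))")
      case True then show ?thesis using stay x by metis
    next
      case False
      obtain p p' where p: "(p, (h x, ?y)) \<in> D" "fst p = x" "(p', (h x, ?y)) \<in> D" "fst p' = x'"
        using source[OF x(1)] source[OF x(2)] x(3) False by metis
      then have "p = p'" using in_unique[OF p(1) p(3)] False by auto
      then show ?thesis using p by blast
    qed
  qed
  have surj: "z \<in> h ` ?S" if z: "z \<in> row (Suc k)" for z
  proof (cases "even (z + int (Suc k))")
    case True
    then have d: "((z, ?y), (z, ?y - 1)) \<in> D" using z row_even_iff by blast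
    then have "z \<in> ?S" using moving_iff[OF k True] by force
    moreover have "h z = z" using h_arc[OF d True] by simp
    ultimately show ?thesis by (metis image_eqI)
  next
    case False
    then obtain q where q: "(q, (z, ?y)) \<in> D" "?y \<le> snd q"
      using z row_odd_iff[OF False] by blast
    \<comment> \<open>The arc comes from above, where the particle stayed in its column, or from a
      horizontal neighbour, from which it jumped.\<close>
    then consider "q = (z, - int k)" | x where "q = (x, ?y)" "x = z + 1 \<or> x = z - 1"
      using neighbour[OF disjI2[OF q(1)]] by auto
    then show ?thesis
    proof cases
      case 1
      then have "z \<in> ?S" using staying_iff[OF k False] q(1) by blast
      then show ?thesis using h_odd[OF False] by (metis image_eqI)
    next
      case (2 x)
      then have ev: "even (x + int (Suc k))" using False by auto
      have "x \<in> ?S" using moving_iff[OF k ev] q(1) 2 by force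
      moreover have "h x = z" using h_arc[of x "(z, ?y)"] q(1) 2 ev by simp
      ultimately show ?thesis by (metis image_eqI)
    qed
  qed
  have "bij_betw h ?S (row (Suc k))"
    unfolding bij_betw_def using inj into surj by blast
  then show ?thesis unfolding hop_def using hop1 h_odd by blast
qed

text \<open>Nothing lies below the bottom row, so its odd sites are empty and every arc into an even
  vertex counts.\<close>

lemma row_bottom: "row N = bpos N ` {i. i < N \<and> (\<exists>q. (q, Bv N (Suc i)) \<in> D)}"
proof (intro equalityI subsetI)
  fix x assume x: "x \<in> row N"
  have no: "((x, - int N), (x, - int N - 1)) \<notin> D" using arc by (fastforce simp: GV_iff)
  then have odd: "odd (x + int N)" and q: "\<exists>q. (q, (x, - int N)) \<in> D" and "\<bar>x\<bar> \<le> int N"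
    using x by (auto simp: row_def split: if_splits)
  define i where "i = nat ((x + int N - 1) div 2)"
  \<comment> \<open>Excluding the row ends, which are odd vertices, keeps \<open>i\<close> between 0
    and \<open>N - 1\<close>.\<close>
  have "x \<noteq> - int N" "x \<noteq> int N" using odd by auto
  then have "0 \<le> x + int N - 1" "x + int N - 1 < 2 * int N" "2 * ((x + int N - 1) div 2) = x + int N - 1"
    using odd \<open>\<bar>x\<bar> \<le> int N\<close> by auto
  then have "x = bpos N i" "i < N" by (auto simp: bpos_def i_def)
  moreover have "Bv N (Suc i) = (bpos N i, - int N)" by (simp add: Bv_def bpos_def)
  ultimately show "x \<in> bpos N ` {i. i < N \<and> (\<exists>q. (q, Bv N (Suc i)) \<in> D)}" using q by auto
next
  fix x assume "x \<in> bpos N ` {i. i < N \<and> (\<exists>q. (q, Bv N (Suc i)) \<in> D)}"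
  then obtain i q where i: "x = bpos N i" "i < N" "(q, Bv N (Suc i)) \<in> D" by blast
  have B: "Bv N (Suc i) = (x, - int N)" using i by (simp add: Bv_def bpos_def)
  have "odd (x + int N)" using i by (auto simp: bpos_def)
  moreover have "- int N \<le> snd q" using arc[OF i(3)] by (cases q) (auto simp: GV_iff)
  ultimately show "x \<in> row N" using i(3) row_odd_iff unfolding B by blast
qed

end

section \<open>The two matchings of an oriented TFPL\<close>

text \<open>\<open>card\<close> is 0 on infinite sets, so bounds on \<open>degree\<close> are
  informative only once finiteness is known.\<close>

lemma finite_GE: "finite (GE N)"
proof (rule finite_subset)
  show "GE N \<subseteq> Pow ({- int N..int N} \<times> {- int N..- 1})"
    by (auto simp: GE_def GV_iff)
qed simp

lemma GE_adjacent:
  assumes "{p, q} \<in> GE N"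
  shows "p \<in> GV N \<and> q \<in> GV N \<and> \<bar>fst p - fst q\<bar> + \<bar>snd p - snd q\<bar> = 1"
proof -
  obtain a b where ab: "{p, q} = {a, b}" "a \<in> GV N" "b \<in> GV N"
    "\<bar>fst a - fst b\<bar> + \<bar>snd a - snd b\<bar> = 1"
    using assms unfolding GE_def by blast
  then have "p = a \<and> q = b \<or> p = b \<and> q = a" by (simp add: doubleton_eq_iff)
  then show ?thesis using ab(2-4) by (auto simp: abs_minus_commute)
qed

locale oriented_tfpl =
  fixes N :: nat and D :: "(vert \<times> vert) set"
  assumes oriented: "is_oriented_TFPL N D"
begin

definition boundary :: "vert set" where
  "boundary = Lv N ` {1..N} \<union> Rv N ` {1..N} \<union> Bv N ` {1..N}"

lemma und_GE: "und D \<subseteq> GE N"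
  and antisym: "(p, q) \<in> D \<Longrightarrow> (q, p) \<notin> D"
  and no_arc_into_L: "i \<in> {1..N} \<Longrightarrow> (q, Lv N i) \<notin> D"
  and no_arc_from_R: "i \<in> {1..N} \<Longrightarrow> (Rv N i, q) \<notin> D"
  and degree_B: "i \<in> {1..N} \<Longrightarrow> degree (und D) (Bv N i) = 1"
  using oriented unfolding is_oriented_TFPL_def is_TFPL_def by blast+

lemma degree_boundary: "p \<in> boundary \<Longrightarrow> degree (und D) p \<le> 1"
  using oriented by (auto simp: boundary_def is_oriented_TFPL_def is_TFPL_def)

lemma inner:
  assumes "p \<in> GV N" "p \<notin> boundary"
  shows "card {q. (q, p) \<in> D} = 1" "card {q. (p, q) \<in> D} = 1"
  using assms oriented
  by (auto simp: boundary_def is_oriented_TFPL_def is_TFPL_def indeg_def outdeg_def)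

lemma arc_adjacent:
  "(p, q) \<in> D \<Longrightarrow> p \<in> GV N \<and> q \<in> GV N \<and> \<bar>fst p - fst q\<bar> + \<bar>snd p - snd q\<bar> = 1"
  using und_GE by (intro GE_adjacent) (force simp: und_def)

lemma finite_edges: "finite {e \<in> und D. p \<in> e}"
  by (rule finite_subset[OF _ finite_GE]) (use und_GE in blast)

lemma arc_edge:
  assumes "(p, q) \<in> D \<or> (q, p) \<in> D"
  shows "{p, q} \<in> {e \<in> und D. p \<in> e}"
proof -
  have "{a, b} \<in> und D" if "(a, b) \<in> D" for a b
    using imageI[OF that, of "\<lambda>(p, q). {p, q}"] by (simp add: und_def)
  then have "{p, q} \<in> und D" using assms insert_commute[of p q "{}"] by metis
  then show ?thesis by simp
qed

lemma boundary_arc_unique: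
  assumes "p \<in> boundary" "(p, q) \<in> D \<or> (q, p) \<in> D" "(p, q') \<in> D \<or> (q', p) \<in> D"
  shows "q = q'"
proof -
  have single: "\<forall>a\<in>{e \<in> und D. p \<in> e}. \<forall>b\<in>{e \<in> und D. p \<in> e}. a = b"
    using degree_boundary[OF assms(1)] card_le_Suc0_iff_eq[OF finite_edges[of p]]
    unfolding degree_def by simp
  have "{p, q} = {p, q'}"
    by (rule single[rule_format, OF arc_edge[OF assms(2)] arc_edge[OF assms(3)]])
  then show ?thesis by (metis doubleton_eq_iff)
qed

lemma boundary_degree_1_iff:
  assumes "p \<in> boundary"
  shows "degree (und D) p = 1 \<longleftrightarrow> (\<exists>q. (p, q) \<in> D \<or> (q, p) \<in> D)"
proof
  assume "degree (und D) p = 1"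
  then have "{e \<in> und D. p \<in> e} \<noteq> {}" unfolding degree_def by (metis card.empty zero_neq_one)
  then obtain e where "e \<in> und D" "p \<in> e" by blast
  then show "\<exists>q. (p, q) \<in> D \<or> (q, p) \<in> D" by (auto simp: und_def)
next
  assume "\<exists>q. (p, q) \<in> D \<or> (q, p) \<in> D"
  then obtain q where "{p, q} \<in> {e \<in> und D. p \<in> e}" using arc_edge by meson
  then have "{e \<in> und D. p \<in> e} \<noteq> {}" by (rule ex_in_conv[THEN iffD1, OF exI])
  then have "degree (und D) p \<noteq> 0" unfolding degree_def using finite_edges by simp
  then show "degree (und D) p = 1" using degree_boundary[OF assms] by simp
qed

lemma out_arc_unique:
  assumes "(p, q) \<in> D" "(p, q') \<in> D"
  shows "q = q'"
proof (cases "p \<in> boundary")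
  case True then show ?thesis using boundary_arc_unique assms by blast
next
  case False
  then obtain r where "{q. (p, q) \<in> D} = {r}"
    using inner(2) arc_adjacent assms(1) card_1_singletonE by metis
  then show ?thesis using assms by (metis mem_Collect_eq singletonD)
qed

lemma in_arc_unique:
  assumes "(q, p) \<in> D" "(q', p) \<in> D"
  shows "q = q'"
proof (cases "p \<in> boundary")
  case True then show ?thesis using boundary_arc_unique assms by blast
next
  case False
  then obtain r where "{q. (q, p) \<in> D} = {r}"
    using inner(1) arc_adjacent assms(1) card_1_singletonE by metis
  then show ?thesis using assms by (metis mem_Collect_eq singletonD)
qed

lemma inner_arcs:
  assumes "p \<in> GV N" "p \<notin> boundary"
  shows "\<exists>q. (q, p) \<in> D" "\<exists>q. (p, q) \<in> D"
proof -
  show "\<exists>q. (q, p) \<in> D" using inner(1)[OF assms] card_1_singletonE by blast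
  show "\<exists>q. (p, q) \<in> D" using inner(2)[OF assms] card_1_singletonE by blast
qed

text \<open>Boundary vertices of odd colour are row ends; those of even colour lie in the bottom
  row.\<close>

lemma inner_odd: "even (fst p + snd p) \<Longrightarrow> \<bar>fst p\<bar> < - snd p \<Longrightarrow> p \<notin> boundary"
  by (auto simp: boundary_def Lv_def Rv_def Bv_def)

lemma inner_even: "odd (fst p + snd p) \<Longrightarrow> - snd p < int N \<Longrightarrow> p \<notin> boundary"
  by (auto simp: boundary_def Lv_def Rv_def Bv_def)

sublocale fwd: arc_matching N D
  by unfold_locales
    (use arc_adjacent out_arc_unique in_arc_unique inner_arcs inner_odd inner_even in blast)+

sublocale bwd: arc_matching N "D\<inverse>"
proof
  fix p q assume "(p, q) \<in> D\<inverse>"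
  then show "p \<in> GV N \<and> q \<in> GV N \<and> \<bar>fst p - fst q\<bar> + \<bar>snd p - snd q\<bar> = 1"
    using arc_adjacent[of q p] by (simp add: abs_minus_commute)
qed (use out_arc_unique in_arc_unique inner_arcs inner_odd inner_even in blast)+

text \<open>If both systems missed an inner even vertex, its incoming and its outgoing arc would
  both use the edge below it, in opposite directions.\<close>

lemma rows_cover:
  assumes "k < N" "\<bar>x\<bar> \<le> int k" "odd (x + int k)"
  shows "x \<in> fwd.row k \<union> bwd.row k"
proof (rule ccontr)
  assume no: "x \<notin> fwd.row k \<union> bwd.row k"
  have "k > 0"
  proof (rule ccontr)
    assume "\<not> k > 0"
    then show False using assms by auto
  qed
  then have p: "(x, - int k) \<in> GV N" using assms by (auto simp: GV_iff)
  have "(x, - int k) \<notin> boundary" using assms by (intro inner_even) auto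
  then obtain q q' where q: "(q, (x, - int k)) \<in> D" "((x, - int k), q') \<in> D"
    using inner_arcs[OF p] by blast
  then have "\<not> - int k \<le> snd q" "\<not> - int k \<le> snd q'"
    using no q fwd.row_odd_iff[OF assms(3)] bwd.row_odd_iff[OF assms(3)] by blast+
  then have "q = (x, - int k - 1)" "q' = (x, - int k - 1)"
    using fwd.neighbour[of x "- int k" q] fwd.neighbour[of x "- int k" q'] q by auto
  then show False using q antisym by blast
qed

context
  fixes u v w :: "bool list"
  assumes bd: "has_boundary N D u v w"
begin

lemma u_iff: "i \<in> {1..N} \<Longrightarrow> u ! (i - 1) \<longleftrightarrow> (\<exists>q. (Lv N i, q) \<in> D)"
  using bd no_arc_into_L boundary_degree_1_iff[of "Lv N i"]
  unfolding has_boundary_def boundary_def by blast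

lemma v_iff: "i \<in> {1..N} \<Longrightarrow> \<not> v ! (i - 1) \<longleftrightarrow> (\<exists>q. (q, Rv N i) \<in> D)"
  using bd no_arc_from_R boundary_degree_1_iff[of "Rv N i"]
  unfolding has_boundary_def boundary_def by blast

text \<open>\<open>has_boundary\<close> gives only implications; they become equivalences because a
  bottom even vertex has degree exactly 1.\<close>

lemma w_iff:
  assumes i: "i \<in> {1..N}"
  shows "w ! (i - 1) \<longleftrightarrow> (\<exists>q. (q, Bv N i) \<in> D)" "\<not> w ! (i - 1) \<longleftrightarrow> (\<exists>q. (Bv N i, q) \<in> D)"
proof -
  have B: "Bv N i \<in> boundary" using i by (auto simp: boundary_def)
  have ex: "\<exists>q. (Bv N i, q) \<in> D \<or> (q, Bv N i) \<in> D"
    using boundary_degree_1_iff[OF B] degree_B[OF i] by blast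
  have "w ! (i - 1)" if "(q, Bv N i) \<in> D" for q
  proof -
    have "{q. (q, Bv N i) \<in> D} = {q}" using that in_arc_unique by blast
    then have "indeg D (Bv N i) = 1" by (simp add: indeg_def)
    then show ?thesis using bd i unfolding has_boundary_def by blast
  qed
  moreover have "\<not> w ! (i - 1)" if "(Bv N i, q) \<in> D" for q
  proof -
    have "{q. (Bv N i, q) \<in> D} = {q}" using that out_arc_unique by blast
    then have "outdeg D (Bv N i) = 1" by (simp add: outdeg_def)
    then show ?thesis using bd i unfolding has_boundary_def by blast
  qed
  ultimately show "w ! (i - 1) \<longleftrightarrow> (\<exists>q. (q, Bv N i) \<in> D)"
    "\<not> w ! (i - 1) \<longleftrightarrow> (\<exists>q. (Bv N i, q) \<in> D)"
    using ex by blast+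
qed

text \<open>The ends of row \<open>k + 1\<close> are \<open>Lv N (N - k)\<close> and
  \<open>Rv N (Suc k)\<close>. No arc leaves the right end, so blue enters only on the left; no arc
  reaches the left end, so red enters only on the right.\<close>

lemma entering:
  assumes k: "k < N"
  shows "fwd.entering (Suc k) = (if u ! (N - Suc k) then {- int (Suc k)} else {})"
    and "bwd.entering (Suc k) = (if v ! k then {} else {int (Suc k)})"
proof -
  have L: "Lv N (N - k) = (- int (Suc k), - int (Suc k))"
    and R: "Rv N (Suc k) = (int (Suc k), - int (Suc k))"
    using k by (auto simp: Lv_def Rv_def of_nat_diff)
  have i: "N - k \<in> {1..N}" "Suc k \<in> {1..N}" using k by auto
  have ends: "\<bar>x\<bar> = int (Suc k) \<longleftrightarrow> x = - int (Suc k) \<or> x = int (Suc k)" for x by linarith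
  have "u ! (N - Suc k) \<longleftrightarrow> (\<exists>q. ((- int (Suc k), - int (Suc k)), q) \<in> D)"
    using u_iff[OF i(1)] unfolding L by simp
  moreover have "((int (Suc k), - int (Suc k)), q) \<notin> D" for q
    using no_arc_from_R[OF i(2)] unfolding R .
  ultimately show "fwd.entering (Suc k) = (if u ! (N - Suc k) then {- int (Suc k)} else {})"
    unfolding fwd.entering_def ends by (auto simp del: of_nat_Suc)
  have "\<not> v ! k \<longleftrightarrow> (\<exists>q. (q, (int (Suc k), - int (Suc k))) \<in> D)"
    using v_iff[OF i(2)] unfolding R by simp
  moreover have "(q, (- int (Suc k), - int (Suc k))) \<notin> D" for q
    using no_arc_into_L[OF i(1)] unfolding L .
  ultimately show "bwd.entering (Suc k) = (if v ! k then {} else {int (Suc k)})"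
    unfolding bwd.entering_def ends by (auto simp del: of_nat_Suc)
qed

lemma particle_rows: "particle_rows N u v w fwd.row bwd.row"
proof
  show "length u = N" "length v = N" "length w = N"
    using bd by (auto simp: has_boundary_def)
  show "fwd.row 0 = {}" "bwd.row 0 = {}" by (rule fwd.row_0 bwd.row_0)+
  show "fwd.row k \<subseteq> {- int k..int k}" "bwd.row k \<subseteq> {- int k..int k}" for k
    by (rule fwd.row_range bwd.row_range)+
  show "hop (int (Suc k)) (fwd.row k \<union> (if u ! (N - Suc k) then {- int (Suc k)} else {}))
      (fwd.row (Suc k))" if "k < N" for k
    using fwd.row_hop[OF that] unfolding entering[OF that] .
  show "hop (int (Suc k)) (bwd.row k \<union> (if v ! k then {} else {int (Suc k)}))
      (bwd.row (Suc k))" if "k < N" for k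
    using bwd.row_hop[OF that] unfolding entering[OF that] .
  show "x \<in> fwd.row k \<union> bwd.row k" if "k < N" "\<bar>x\<bar> \<le> int k" "odd (x + int k)" for k x
    using that by (rule rows_cover)
  have w: "w ! i \<longleftrightarrow> (\<exists>q. (q, Bv N (Suc i)) \<in> D)" "\<not> w ! i \<longleftrightarrow> (\<exists>q. (Bv N (Suc i), q) \<in> D)"
    if "i < N" for i
    using w_iff[of "Suc i"] that by simp_all
  show "fwd.row N = bpos N ` {i. i < N \<and> w ! i}"
    unfolding fwd.row_bottom using w(1) by (simp cong: conj_cong)
  show "bwd.row N = bpos N ` {i. i < N \<and> \<not> w ! i}"
    unfolding bwd.row_bottom using w(2) by (simp cong: conj_cong)
qed

end

end

theorem theorem3p1:
  fixes N :: nat and u v w :: "bool list"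
  assumes "N \<ge> 1"
    and "length u = N" and "length v = N" and "length w = N"
    and "\<exists>D. is_oriented_TFPL N D \<and> has_boundary N D u v w"
  shows "(zeros u = zeros v \<and> zeros v = zeros w) \<and>
         (word_le u w \<and> word_le v w) \<and>
         dinv u + dinv v \<le> dinv w"
proof -
  obtain D where D: "is_oriented_TFPL N D" "has_boundary N D u v w"
    using assms(5) by blast
  interpret oriented_tfpl N D by unfold_locales (rule D(1))
  interpret particle_rows N u v w fwd.row bwd.row by (rule particle_rows[OF D(2)])
  show ?thesis using zeros_u zeros_v u_le_w v_le_w dinv_bound by simp
qed

end
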